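(* Let $k\ge1$ be an integer. Every $k$-$\gamma_c$-critical $K_{1,3}$-free graph of even order with minimum degree $\delta\geq 3$ is bi-critical if and only if $k\in\{1,2\}$.
   Context: A connected dominating set of $G$ is a set $D\subseteq V(G)$ such that every vertex is in $D$ or adjacent to a vertex of $D$ and $G[D]$ is connected; $\gamma_c(G)$ is its minimum size. $G$ is $k$-$\gamma_c$-critical if $\gamma_c(G)=k$ and $\gamma_c(G+uv)<k$ for every pair of non-adjacent vertices $u,v$. $G$ is $K_{1,3}$-free if it has no induced subgraph isomorphic to $K_{1,3}$. $G$ is bi-critical if $G-S$ has a perfect matching for every set $S$ of two vertices. *)

theory Defs
  imports
    "Graph_Theory.Graph_Theory"
    "HOL-Library.Extended_Nat"
    "HOL-Library.Infinite_Typeclass"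
begin

text \<open>
  Finite simple graphs are the finite, symmetric, loop-free digraphs without parallel arcs of the
  locale \<^locale>\<open>pair_graph\<close>: an edge \<open>uv\<close> is represented by the two arcs \<open>(u, v)\<close> and \<open>(v, u)\<close>.
\<close>

definition add_edge :: "'a pair_pre_digraph \<Rightarrow> 'a \<Rightarrow> 'a \<Rightarrow> 'a pair_pre_digraph" where
  "add_edge G u v = G\<lparr>parcs := parcs G \<union> {(u, v), (v, u)}\<rparr>"

definition connected_dominating_set :: "'a pair_pre_digraph \<Rightarrow> 'a set \<Rightarrow> bool" where
  "connected_dominating_set G D \<longleftrightarrow>
     D \<subseteq> pverts G \<and>
     (\<forall>v\<in>pverts G. v \<in> D \<or> (\<exists>u\<in>D. (u, v) \<in> parcs G)) \<and>
     connected (with_proj G \<restriction> D)"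

text \<open>
  The value is \<open>\<infinity>\<close> when there is no connected dominating set, i.e. for disconnected graphs and
  (since \<^const>\<open>connected\<close> excludes it) for the null graph. Hence a graph whose connected
  domination number is a natural number is connected and has a vertex.
\<close>

definition connected_domination_number :: "'a pair_pre_digraph \<Rightarrow> enat" where
  "connected_domination_number G = (INF D\<in>{D. connected_dominating_set G D}. enat (card D))"

definition connected_domination_critical :: "nat \<Rightarrow> 'a pair_pre_digraph \<Rightarrow> bool" where
  "connected_domination_critical k G \<longleftrightarrow>
     connected_domination_number G = enat k \<and>
     (\<forall>u\<in>pverts G. \<forall>v\<in>pverts G. u \<noteq> v \<and> (u, v) \<notin> parcs G \<longrightarrow>
        connected_domination_number (add_edge G u v) < enat k)"

definition claw_free :: "'a pair_pre_digraph \<Rightarrow> bool" where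
  "claw_free G \<longleftrightarrow>
     \<not> (\<exists>H. induced_subgraph H (with_proj G) \<and> complete_bipartite_digraph 1 3 H)"

text \<open>In a symmetric digraph the out-degree of a vertex is its degree.\<close>

definition min_degree :: "'a pair_pre_digraph \<Rightarrow> nat" where
  "min_degree G = (MIN v\<in>pverts G. out_degree (with_proj G) v)"

text \<open>The edges of a matching are taken as unordered pairs.\<close>

definition perfect_matching :: "('a, 'b) pre_digraph \<Rightarrow> 'a set set \<Rightarrow> bool" where
  "perfect_matching G M \<longleftrightarrow>
     M \<subseteq> {{u, v} |u v. (u, v) \<in> arcs_ends G} \<and> (\<forall>v\<in>verts G. \<exists>!e. e \<in> M \<and> v \<in> e)"

definition bi_critical :: "'a pair_pre_digraph \<Rightarrow> bool" where
  "bi_critical G \<longleftrightarrow>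
     (\<forall>S. S \<subseteq> pverts G \<and> card S = 2 \<longrightarrow>
        (\<exists>M. perfect_matching (with_proj G \<restriction> (pverts G - S)) M))"

end

theory Submission
  imports Defs
begin

text \<open>
  For \<open>k \<le> 2\<close> a dominating vertex of \<open>G + uv\<close> must be \<open>u\<close> or \<open>v\<close>, so in the complement of \<open>G\<close> every
  edge has an end of degree one. This property passes to \<open>G - S\<close>, which has no isolated vertex since
  \<open>\<delta> \<ge> 3\<close>; a maximum matching of \<open>G - S\<close> missing two vertices could then be augmented along a path
  with at most three edges.

  For \<open>k \<ge> 3\<close> take the cycle of length \<open>n = k + 2\<close> and replace its vertices by cliques. Such a blow-up
  is always claw-free, and it is \<open>k\<close>-critical: a connected dominating set can miss at most two
  positions of the cycle, whereas a new edge allows it to miss a third one. With two nonadjacent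
  singleton cliques that enclose a triangle, deleting these singletons leaves an odd component.
\<close>

section \<open>Connected domination, matchings and claws\<close>

lemma arcs_ends_induce [simp]:
  "arcs_ends (with_proj G \<restriction> D) = parcs G \<inter> D \<times> D"
  by (auto simp: arcs_ends_conv induce_subgraph_def)

text \<open>On a symmetric arc relation \<open>mk_symmetric\<close> changes nothing, and
  \<open>rtrancl_on\<close> differs from the ordinary closure only by requiring the start to lie in
  \<open>D\<close>.\<close>

lemma connected_induce_iff:
  assumes "sym (parcs G)"
  shows "connected (with_proj G \<restriction> D) \<longleftrightarrow>
    D \<noteq> {} \<and> (\<forall>u\<in>D. \<forall>v\<in>D. (u, v) \<in> (parcs G \<inter> D \<times> D)\<^sup>*)"
proof -
  have sym: "mk_symmetric (with_proj G \<restriction> D) = \<lparr>pverts = D, parcs = parcs G \<inter> D \<times> D\<rparr>"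
    using assms by (auto simp: mk_symmetric_def induce_subgraph_def dest: symD)
  have "(u, v) \<in> rtrancl_on D (parcs G \<inter> D \<times> D) \<longleftrightarrow> (u, v) \<in> (parcs G \<inter> D \<times> D)\<^sup>*"
    if "u \<in> D" for u v
  proof
    assume "(u, v) \<in> (parcs G \<inter> D \<times> D)\<^sup>*"
    then show "(u, v) \<in> rtrancl_on D (parcs G \<inter> D \<times> D)"
    proof induction
      case base
      then show ?case using that by simp
    next
      case (step y z)
      then show ?case by (auto intro: rtrancl_on_into_rtrancl_on)
    qed
  qed (rule rtrancl_on_rtranclI)
  then show ?thesis
    unfolding connected_def strongly_connected_def sym reachable_def by auto
qed

text \<open>One root suffices: by symmetry any two vertices are joined through
  \<open>w\<close>.\<close>

lemma connected_induceI:
  assumes "sym (parcs G)" "w \<in> D" "\<And>v. v \<in> D \<Longrightarrow> (w, v) \<in> (parcs G \<inter> D \<times> D)\<^sup>*"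
  shows "connected (with_proj G \<restriction> D)"
proof -
  have "sym ((parcs G \<inter> D \<times> D)\<^sup>*)"
    using assms(1) by (intro sym_rtrancl) (auto simp: sym_def)
  with assms show ?thesis
    by (auto simp: connected_induce_iff) (meson symD rtrancl_trans)
qed

text \<open>A path inside \<open>D\<close> from \<open>x\<close> to \<open>y\<close> has to leave
  \<open>X\<close> along some arc. This is the tool for showing that certain sets are not
  connected.\<close>

lemma connected_induce_crossing_arc:
  assumes "sym (parcs G)" "connected (with_proj G \<restriction> D)" "x \<in> X" "x \<in> D" "y \<in> D" "y \<notin> X"
  obtains u v where "u \<in> X" "v \<notin> X" "u \<in> D" "v \<in> D" "(u, v) \<in> parcs G"
proof -
  have "(x, y) \<in> (parcs G \<inter> D \<times> D)\<^sup>*"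
    using assms by (simp add: connected_induce_iff)
  then have "y \<notin> X \<Longrightarrow> \<exists>u\<in>X. \<exists>v. v \<notin> X \<and> (u, v) \<in> parcs G \<inter> D \<times> D"
    by (induction) (use assms in auto)
  then show ?thesis using assms that by auto
qed

section \<open>The connected domination number and added edges\<close>

lemma connected_domination_number_le:
  "connected_dominating_set G D \<Longrightarrow> connected_domination_number G \<le> enat (card D)"
  unfolding connected_domination_number_def by (rule INF_lower) simp

lemma connected_domination_number_lessE:
  assumes "connected_domination_number G < enat k"
  obtains D where "connected_dominating_set G D" "card D < k"
  using assms unfolding connected_domination_number_def INF_less_iff by auto

lemma (in pair_graph) sym_parcs: "sym (parcs G)"
  by (meson arcs_symmetric symI)

lemma add_edge_simps [simp]:
  "pverts (add_edge G u v) = pverts G"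
  "parcs (add_edge G u v) = parcs G \<union> {(u, v), (v, u)}"
  by (simp_all add: add_edge_def)

lemma sym_add_edge: "sym (parcs G) \<Longrightarrow> sym (parcs (add_edge G u v))"
  by (auto simp: sym_def)

lemma add_edge_commute: "add_edge G u v = add_edge G v u"
  by (simp add: add_edge_def insert_commute)

section \<open>Minimum degree, claws and odd components\<close>

lemma min_degree_geD:
  assumes "finite (pverts G)" "v \<in> pverts G" "d \<le> min_degree G"
  shows "d \<le> card {w. (v, w) \<in> parcs G}"
proof -
  have "out_arcs (with_proj G) v = Pair v ` {w. (v, w) \<in> parcs G}"
    by (auto simp: out_arcs_def)
  then have "out_degree (with_proj G) v = card {w. (v, w) \<in> parcs G}"
    by (simp add: out_degree_def card_image inj_on_def)
  moreover have "min_degree G \<le> out_degree (with_proj G) v"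
    unfolding min_degree_def using assms by (intro Min_le) auto
  ultimately show ?thesis using assms by simp
qed

lemma min_degree_geI:
  assumes "finite (pverts G)" "finite (parcs G)" "pverts G \<noteq> {}"
    and "\<And>v. v \<in> pverts G \<Longrightarrow> \<exists>W. card W = d \<and> Pair v ` W \<subseteq> parcs G"
  shows "d \<le> min_degree G"
proof -
  have "d \<le> out_degree (with_proj G) v" if v: "v \<in> pverts G" for v
  proof -
    obtain W where W: "card W = d" "Pair v ` W \<subseteq> parcs G"
      using assms(4)[OF v] by blast
    have "card (Pair v ` W) \<le> card (out_arcs (with_proj G) v)"
      using W assms(2) by (intro card_mono) (auto simp: out_arcs_def)
    with W show ?thesis by (simp add: out_degree_def card_image inj_on_def)
  qed
  then show ?thesis unfolding min_degree_def using assms by (subst Min_ge_iff) auto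
qed

text \<open>An induced subgraph keeps every arc between its vertices, so a claw amounts to a centre
  with three pairwise nonadjacent neighbours.\<close>

lemma claw_freeI:
  assumes "\<And>x a b d. \<lbrakk>(x, a) \<in> parcs G; (x, b) \<in> parcs G; (x, d) \<in> parcs G;
      a \<noteq> b; a \<noteq> d; b \<noteq> d; (a, b) \<notin> parcs G; (a, d) \<notin> parcs G; (b, d) \<notin> parcs G\<rbrakk> \<Longrightarrow> False"
  shows "claw_free G"
  unfolding claw_free_def
proof
  assume "\<exists>H. induced_subgraph H (with_proj G) \<and> complete_bipartite_digraph 1 3 H"
  then obtain H U W where H: "induced_subgraph H (with_proj G)"
    and UW: "verts H = U \<union> W" "U \<inter> W = {}" "card U = 1" "card W = 3"
      "arcs_ends H = U \<times> W \<union> W \<times> U"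
    unfolding complete_bipartite_digraph_def by auto
  have ends: "arcs_ends H = parcs G \<inter> verts H \<times> verts H"
    using H unfolding induced_subgraph_def subgraph_def compatible_def arcs_ends_conv by auto
  obtain x where x: "U = {x}" using UW card_1_singletonE by blast
  obtain a b d where abd: "W = {a, b, d}" "a \<noteq> b" "a \<noteq> d" "b \<noteq> d"
    using UW card_3_iff by metis
  have iff: "(p, q) \<in> parcs G \<longleftrightarrow> (p, q) \<in> U \<times> W \<union> W \<times> U"
    if "p \<in> U \<union> W" "q \<in> U \<union> W" for p q
    using that ends UW by auto
  show False
  proof (rule assms[of x a b d])
    show "(x, a) \<in> parcs G" "(x, b) \<in> parcs G" "(x, d) \<in> parcs G"
      using iff[of x a] iff[of x b] iff[of x d] x abd by simp_all
    show "(a, b) \<notin> parcs G" "(a, d) \<notin> parcs G" "(b, d) \<notin> parcs G"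
      using iff[of a b] iff[of a d] iff[of b d] x abd UW(2) by auto
  qed (use abd in auto)
qed

text \<open>\<open>T\<close> is a union of components of \<open>G - S\<close>, so the edges of a
  perfect matching of \<open>G - S\<close> that meet \<open>T\<close> split it into pairs. This is
  the easy direction of Tutte's condition; an odd \<open>T\<close> refutes bi-criticality.\<close>

lemma bi_critical_closed_even:
  assumes "pair_graph G" "bi_critical G" "S \<subseteq> pverts G" "card S = 2" "T \<subseteq> pverts G - S"
    and closed: "\<And>u v. \<lbrakk>(u, v) \<in> parcs G; u \<in> T; v \<notin> S\<rbrakk> \<Longrightarrow> v \<in> T"
  shows "even (card T)"
proof -
  interpret pair_graph G by fact
  obtain M where "perfect_matching (with_proj G \<restriction> (pverts G - S)) M"
    using assms(2-4) unfolding bi_critical_def by blast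
  then have M: "M \<subseteq> {{u, v} |u v. (u, v) \<in> parcs G \<inter> (pverts G - S) \<times> (pverts G - S)}"
    and ex1: "\<And>v. v \<in> pverts G - S \<Longrightarrow> \<exists>!e. e \<in> M \<and> v \<in> e"
    by (simp_all add: perfect_matching_def)
  define N where "N = {e \<in> M. e \<inter> T \<noteq> {}}"
  have edge: "e \<subseteq> T \<and> finite e \<and> card e = 2" if "e \<in> N" for e
  proof -
    obtain u v where uv: "e = {u, v}" "(u, v) \<in> parcs G" "u \<notin> S" "v \<notin> S"
      using \<open>e \<in> N\<close> M by (force simp: N_def)
    then have "(v, u) \<in> parcs G" "u \<noteq> v" using arcs_symmetric no_loops' by blast+
    moreover have "u \<in> T \<or> v \<in> T" using \<open>e \<in> N\<close> uv(1) by (auto simp: N_def)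
    ultimately show ?thesis using uv closed by (auto simp: card_insert_if)
  qed
  have Un: "\<Union>N = T"
  proof
    show "T \<subseteq> \<Union>N"
    proof
      fix v assume v: "v \<in> T"
      then obtain e where "e \<in> M" "v \<in> e" using ex1 \<open>T \<subseteq> pverts G - S\<close> by blast
      with v show "v \<in> \<Union>N" by (auto simp: N_def)
    qed
  qed (use edge in blast)
  have "disjoint N"
  proof (rule pairwiseI)
    fix e f assume "e \<in> N" "f \<in> N" "e \<noteq> f"
    then show "disjnt e f"
      using ex1 edge assms(5) unfolding disjnt_def N_def by blast
  qed
  then have "card T = sum card N"
    using card_Union_disjoint[of N] edge Un by simp
  also have "\<dots> = 2 * card N" using edge by (subst sum.cong[of N N card "\<lambda>_. 2"]) auto
  finally show ?thesis by simp
qed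

lemma rtrancl_interval:
  fixes r :: "int \<Rightarrow> 'a"
  assumes "sym R" and step: "\<And>t. \<lbrakk>a \<le> t; t < b\<rbrakk> \<Longrightarrow> (r t, r (t + 1)) \<in> R"
    and "s \<in> {a..b}" "t \<in> {a..b}"
  shows "(r s, r t) \<in> R\<^sup>*"
proof -
  have up: "(r s, r t) \<in> R\<^sup>*" if "s \<le> t" "a \<le> s" "t \<le> b" for s t
    using that
  proof (induction t rule: int_ge_induct)
    case (step t)
    then show ?case using assms(2)[of t] by (auto intro: rtrancl_into_rtrancl)
  qed simp
  have "sym (R\<^sup>*)" using \<open>sym R\<close> by (rule sym_rtrancl)
  then show ?thesis using up[of s t] up[of t s] assms(3,4)
    by (cases "s \<le> t") (auto dest: symD)
qed

section \<open>The cases \<open>k \<le> 2\<close>\<close>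

text \<open>By parity, a maximum matching that is not perfect misses two vertices \<open>u\<close>
  and \<open>v\<close>. They are nonadjacent, so one of them, say \<open>v\<close>, is adjacent to
  all other vertices. A neighbour \<open>a\<close> of \<open>u\<close> is covered by some edge
  \<open>{a, b}\<close>, and exchanging this edge for \<open>{u, a}\<close> and
  \<open>{v, b}\<close> enlarges the matching.\<close>

lemma perfect_matching_cocktail:
  assumes "finite W" "even (card W)" and sym: "sym E" and irrefl: "irrefl E"
    and no_isolated: "\<And>u. u \<in> W \<Longrightarrow> \<exists>v\<in>W. (u, v) \<in> E"
    and dominated: "\<And>u v. \<lbrakk>u \<in> W; v \<in> W; u \<noteq> v; (u, v) \<notin> E\<rbrakk> \<Longrightarrow>
      (\<forall>x\<in>W - {u, v}. (u, x) \<in> E) \<or> (\<forall>x\<in>W - {u, v}. (v, x) \<in> E)"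
  obtains M where "M \<subseteq> {{u, v} |u v. (u, v) \<in> E \<inter> W \<times> W}" "disjoint M" "\<Union>M = W"
proof -
  define Ed where "Ed = {{u, v} |u v. (u, v) \<in> E \<inter> W \<times> W}"
  have Ed_sub: "e \<subseteq> W" "card e = 2" if "e \<in> Ed" for e
    using that irrefl by (auto simp: Ed_def irrefl_def card_insert_if)
  have EdI: "{u, v} \<in> Ed" if "(u, v) \<in> E" "u \<in> W" "v \<in> W" for u v
    using that by (auto simp: Ed_def)
  have fin_Ed: "finite Ed" using Ed_sub(1) \<open>finite W\<close> by (meson PowI finite_Pow_iff finite_subset subsetI)
  define Ms where "Ms = {M. M \<subseteq> Ed \<and> disjoint M}"
  have fin_Ms: "finite Ms" unfolding Ms_def using fin_Ed by simp
  have "{} \<in> Ms" by (simp add: Ms_def)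
  then have "Max (card ` Ms) \<in> card ` Ms" using fin_Ms by (intro Max_in) auto
  then obtain M where M: "M \<in> Ms" and "card M = Max (card ` Ms)" by force
  then have max: "\<And>N. N \<in> Ms \<Longrightarrow> card N \<le> card M" using fin_Ms by simp
  have M_Ed: "M \<subseteq> Ed" and disj: "disjoint M" using M by (auto simp: Ms_def)
  have fin_M: "finite M" using M_Ed fin_Ed finite_subset by blast
  have M_W: "\<Union>M \<subseteq> W" using M_Ed Ed_sub by blast
  have augment1: False if "e \<in> Ed" "e \<inter> \<Union>M = {}" for e
  proof -
    have "insert e M \<in> Ms" using that M_Ed disj
      by (auto simp: Ms_def pairwise_insert disjnt_def)
    moreover have "e \<noteq> {}" using Ed_sub(2)[OF that(1)] by auto
    then have "e \<notin> M" using that by blast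
    ultimately show False using max[of "insert e M"] fin_M by simp
  qed
  \<comment> \<open>Augmentation along a path with three edges: the middle edge \<open>f\<close> is
    traded for the two outer ones.\<close>
  have augment2: False if "f \<in> M" "e1 \<in> Ed" "e2 \<in> Ed" "e1 \<inter> e2 = {}"
    "e1 \<inter> \<Union>(M - {f}) = {}" "e2 \<inter> \<Union>(M - {f}) = {}" for f e1 e2
  proof -
    have "disjoint (M - {f})" using disj by (rule pairwise_subset) blast
    moreover have "disjnt e1 g" "disjnt g e1" "disjnt e2 g" "disjnt g e2" if "g \<in> M - {f}" for g
      using that \<open>e1 \<inter> \<Union>(M - {f}) = {}\<close> \<open>e2 \<inter> \<Union>(M - {f}) = {}\<close>
      by (auto simp: disjnt_def)
    moreover have "disjnt e1 e2" "disjnt e2 e1" using \<open>e1 \<inter> e2 = {}\<close> by (auto simp: disjnt_def)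
    ultimately have "disjoint (insert e1 (insert e2 (M - {f})))"
      unfolding pairwise_insert by blast
    then have "insert e1 (insert e2 (M - {f})) \<in> Ms"
      using that(2,3) M_Ed by (auto simp: Ms_def)
    moreover have "e1 \<noteq> {}" "e2 \<noteq> {}" using Ed_sub(2)[of e1] Ed_sub(2)[of e2] that by auto
    then have "e1 \<notin> insert e2 (M - {f})" "e2 \<notin> M - {f}" using that by blast+
    then have "card (insert e1 (insert e2 (M - {f}))) = Suc (card M)"
      using fin_M card_Suc_Diff1[OF fin_M \<open>f \<in> M\<close>] by simp
    ultimately show False using max by fastforce
  qed
  have "\<Union>M = W"
  proof (rule ccontr)
    assume "\<Union>M \<noteq> W"
    then have ne: "W - \<Union>M \<noteq> {}" using M_W by blast
    have "finite e" if "e \<in> M" for e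
      using that M_W \<open>finite W\<close> by (meson Union_upper finite_subset order_trans)
    with disj have "card (\<Union>M) = sum card M" by (rule card_Union_disjoint)
    also have "\<dots> = 2 * card M" using M_Ed Ed_sub(2) by (subst sum.cong[of M M card "\<lambda>_. 2"]) auto
    finally have "even (card (W - \<Union>M))"
      using \<open>even (card W)\<close> M_W \<open>finite W\<close> by (simp add: card_Diff_subset finite_subset)
    \<comment> \<open>The uncovered set is nonempty and, being even, not a singleton, so it has two
      distinct members.\<close>
    then have "card (W - \<Union>M) \<noteq> 1" by auto
    then obtain u v where uv: "u \<in> W - \<Union>M" "v \<in> W - \<Union>M" "u \<noteq> v"
      using ne by (metis is_singletonI' is_singleton_altdef)
    have key: False
      if uv: "u \<in> W - \<Union>M" "v \<in> W - \<Union>M" "u \<noteq> v" "(u, v) \<notin> E"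
        and v: "\<forall>x\<in>W - {u, v}. (v, x) \<in> E" for u v
    proof -
      obtain a where a: "a \<in> W" "(u, a) \<in> E" using no_isolated uv by blast
      have "a \<noteq> u" "a \<noteq> v" using a uv irrefl by (auto simp: irrefl_def)
      show False
      proof (cases "a \<in> \<Union>M")
        case False
        then show False using augment1[of "{u, a}"] EdI a uv by auto
      next
        case True
        then obtain f where f: "f \<in> M" "a \<in> f" by blast
        have "card f = 2" using Ed_sub M_Ed f by blast
        then obtain b where b: "f = {a, b}" "a \<noteq> b"
          using f(2) by (auto simp: card_2_iff)
        have bW: "b \<in> W" "b \<noteq> u" "b \<noteq> v" using f(1) b M_W uv by auto
        have "x \<notin> \<Union>(M - {f})" if "x \<in> f" for x
          using disj f(1) that by (auto simp: pairwise_def disjnt_def)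
        then show False
          using augment2[of f "{u, a}" "{v, b}"] f b bW uv a v \<open>a \<noteq> u\<close> \<open>a \<noteq> v\<close>
            EdI[of u a] EdI[of v b]
          by auto
      qed
    qed
    have "(u, v) \<notin> E" "(v, u) \<notin> E"
      using augment1[of "{u, v}"] EdI[of u v] uv sym by (auto dest: symD)
    then show False
      using dominated[of u v] key[of u v] key[of v u] uv by (auto simp: insert_commute)
  qed
  then show ?thesis using that M_Ed disj by (simp add: Ed_def)
qed

text \<open>A connected dominating set is nonempty, so that of \<open>G + uv\<close> is a single
  vertex \<open>w\<close>, and \<open>k = 2\<close>; for \<open>k = 1\<close> no nonadjacent pair
  exists. Were \<open>w\<close> neither \<open>u\<close> nor \<open>v\<close>, the new edge would
  not touch it and \<open>w\<close> would dominate \<open>G\<close> already.\<close>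

lemma critical_nonadjacent_dominating:
  assumes "pair_graph G" and crit: "connected_domination_critical k G" and "k \<le> 2"
    and uv: "u \<in> pverts G" "v \<in> pverts G" "u \<noteq> v" "(u, v) \<notin> parcs G"
  shows "(\<forall>x\<in>pverts G - {u, v}. (u, x) \<in> parcs G) \<or> (\<forall>x\<in>pverts G - {u, v}. (v, x) \<in> parcs G)"
proof -
  interpret pair_graph G by fact
  have sym: "sym (parcs (add_edge G u v))" by (simp only: sym_add_edge sym_parcs)
  have "connected_domination_number (add_edge G u v) < enat k"
    using crit uv by (auto simp: connected_domination_critical_def)
  then obtain D where D: "connected_dominating_set (add_edge G u v) D" "card D < k"
    by (rule connected_domination_number_lessE)
  have "D \<noteq> {}" "D \<subseteq> pverts G" using D(1) sym
    by (auto simp: connected_dominating_set_def connected_induce_iff)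
  moreover have "finite D" using \<open>D \<subseteq> pverts G\<close> pair_finite_verts finite_subset by blast
  ultimately have "card D = 1" using \<open>k \<le> 2\<close> D(2) card_gt_0_iff[of D] by linarith
  then have k: "k = 2" using D(2) \<open>k \<le> 2\<close> by linarith
  from \<open>card D = 1\<close> obtain w where w: "D = {w}" by (rule card_1_singletonE)
  have dom: "x = w \<or> (w, x) \<in> parcs G \<union> {(u, v), (v, u)}" if "x \<in> pverts G" for x
    using D(1) that w by (auto simp: connected_dominating_set_def)
  have "w = u \<or> w = v"
  proof (rule ccontr)
    assume "\<not> (w = u \<or> w = v)"
    then have "connected_dominating_set G {w}"
      using dom w \<open>D \<subseteq> pverts G\<close>
      by (auto simp: connected_dominating_set_def connected_induce_iff[OF sym_parcs])
    then have "connected_domination_number G \<le> enat 1"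
      using connected_domination_number_le by fastforce
    then show False using crit k by (simp add: connected_domination_critical_def)
  qed
  then show ?thesis using dom by auto
qed

lemma critical_le_2_imp_bi_critical:
  assumes "pair_graph G" "connected_domination_critical k G" "k \<le> 2"
    and "even (card (pverts G))" "min_degree G \<ge> 3"
  shows "bi_critical G"
  unfolding bi_critical_def
proof (intro allI impI)
  interpret pair_graph G by fact
  fix S assume S: "S \<subseteq> pverts G \<and> card S = 2"
  then have "finite S" by (auto intro: card_ge_0_finite)
  define W where "W = pverts G - S"
  have finW: "finite W" by (simp add: W_def pair_finite_verts)
  have evenW: "even (card W)"
    using assms(4) S \<open>finite S\<close> by (simp add: W_def card_Diff_subset)
  \<comment> \<open>A vertex isolated in \<open>G - S\<close> has all its neighbours in
    \<open>S\<close>, hence degree at most 2.\<close>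
  have isolated: "\<exists>v\<in>W. (u, v) \<in> parcs G" if "u \<in> W" for u
  proof (rule ccontr)
    assume "\<not> ?thesis"
    then have "{w. (u, w) \<in> parcs G} \<subseteq> S" using in_arcsD2 by (auto simp: W_def)
    then have "card {w. (u, w) \<in> parcs G} \<le> 2" using S \<open>finite S\<close> card_mono by metis
    then show False
      using min_degree_geD[OF pair_finite_verts _ assms(5), of u] that by (auto simp: W_def)
  qed
  have irrefl: "irrefl (parcs G)" using no_loops' by (auto simp: irrefl_def)
  have dominated: "(\<forall>x\<in>W - {u, v}. (u, x) \<in> parcs G) \<or> (\<forall>x\<in>W - {u, v}. (v, x) \<in> parcs G)"
    if "u \<in> W" "v \<in> W" "u \<noteq> v" "(u, v) \<notin> parcs G" for u v
    using critical_nonadjacent_dominating[OF assms(1-3), of u v] that by (auto simp: W_def)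
  obtain M where M: "M \<subseteq> {{u, v} |u v. (u, v) \<in> parcs G \<inter> W \<times> W}" "disjoint M" "\<Union>M = W"
    by (rule perfect_matching_cocktail[OF finW evenW sym_parcs irrefl isolated dominated])
  have "\<exists>!e. e \<in> M \<and> v \<in> e" if "v \<in> W" for v
    using M(2,3) that unfolding pairwise_def disjnt_def by blast
  with M(1) have "perfect_matching (with_proj G \<restriction> W) M"
    by (simp add: perfect_matching_def)
  then show "\<exists>M. perfect_matching (with_proj G \<restriction> (pverts G - S)) M"
    by (auto simp: W_def)
qed

section \<open>Blow-ups of cycles\<close>

text \<open>
  \<open>c\<close> sends a vertex to its position on the cycle of length \<open>n\<close>, and only its residue modulo \<open>n\<close>
  matters; the fibres become cliques and neighbouring fibres are completely joined.
\<close>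

locale cycle_blowup =
  fixes V :: "'a set" and c :: "'a \<Rightarrow> int" and n :: int
  assumes finite_V: "finite V" and n_ge_5: "5 \<le> n"
    and inhabited: "\<exists>u\<in>V. c u mod n = i mod n"
begin

section \<open>Arcs, symmetry and claw-freeness of a blow-up\<close>

definition blowup :: "'a pair_pre_digraph" where
  "blowup = \<lparr>pverts = V, parcs =
     {(u, v). u \<in> V \<and> v \<in> V \<and> u \<noteq> v \<and> (\<exists>e\<in>{-1, 0, 1}. c v mod n = (c u + e) mod n)}\<rparr>"

lemma pverts_blowup [simp]: "pverts blowup = V"
  by (simp add: blowup_def)

lemma arc_iff:
  "(u, v) \<in> parcs blowup \<longleftrightarrow>
    u \<in> V \<and> v \<in> V \<and> u \<noteq> v \<and> (\<exists>e\<in>{-1, 0, 1}. c v mod n = (c u + e) mod n)"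
  by (simp add: blowup_def)

lemma mod_shift: "(a + e) mod n = (b + e) mod n \<longleftrightarrow> a mod n = (b :: int) mod n"
  by (simp add: mod_eq_dvd_iff)

lemma sym_blowup: "sym (parcs blowup)"
proof (rule symI)
  fix u v assume uv: "(u, v) \<in> parcs blowup"
  then obtain e where e: "e \<in> {-1, 0, 1}" "c v mod n = (c u + e) mod n"
    unfolding arc_iff by blast
  from e(2) have "c u mod n = (c v + (- e)) mod n"
    using mod_shift[of "c v" "- e" "c u + e"] by simp
  moreover have "- e \<in> {-1, 0, 1}" using e(1) by auto
  ultimately show "(v, u) \<in> parcs blowup" using uv unfolding arc_iff by blast
qed

lemma pair_graph_blowup: "pair_graph blowup"
proof
  have "parcs blowup \<subseteq> V \<times> V" by (auto simp: arc_iff)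
  then show "finite (parcs blowup)" using finite_V finite_subset by blast
  show "symmetric (with_proj blowup)" by (simp add: symmetric_def sym_blowup)
qed (auto simp: arc_iff finite_V)

text \<open>The neighbours of \<open>x\<close> sit at offsets in \<open>{-1, 0, 1}\<close> from it,
  and two of them are nonadjacent only if their offsets differ by 2. Three such offsets cannot
  pairwise differ by 2.\<close>

lemma claw_free_blowup: "claw_free blowup"
proof (rule claw_freeI)
  fix x p q r
  assume arcs: "(x, p) \<in> parcs blowup" "(x, q) \<in> parcs blowup" "(x, r) \<in> parcs blowup"
    and "p \<noteq> q" "p \<noteq> r" "q \<noteq> r"
    and non: "(p, q) \<notin> parcs blowup" "(p, r) \<notin> parcs blowup" "(q, r) \<notin> parcs blowup"
  obtain e f g where efg: "e \<in> {-1, 0, 1}" "f \<in> {-1, 0, 1}" "g \<in> {-1, 0, 1}"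
    "c p mod n = (c x + e) mod n" "c q mod n = (c x + f) mod n" "c r mod n = (c x + g) mod n"
    using arcs unfolding arc_iff by blast
  have diff: "b - a \<notin> {-1, 0, 1}"
    if "c y mod n = (c x + a) mod n" "c z mod n = (c x + b) mod n"
      "(y, z) \<notin> parcs blowup" "y \<noteq> z" "y \<in> V" "z \<in> V" for y z a b
  proof
    assume d: "b - a \<in> {-1, 0, 1}"
    have "c z mod n = (c y + (b - a)) mod n"
      using that(1,2) mod_shift[of "c y" "b - a" "c x + a"] by simp
    with d that show False unfolding arc_iff by blast
  qed
  have "p \<in> V" "q \<in> V" "r \<in> V" using arcs by (auto simp: arc_iff)
  then have "f - e \<notin> {-1, 0, 1}" "g - e \<notin> {-1, 0, 1}" "g - f \<notin> {-1, 0, 1}"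
    using diff efg non \<open>p \<noteq> q\<close> \<open>p \<noteq> r\<close> \<open>q \<noteq> r\<close> by blast+
  with efg(1-3) show False by auto
qed

text \<open>Indexing by all integers lets intervals of positions run past \<open>n\<close>. The
  vertices \<open>r t\<close> and \<open>r (t + n)\<close> share a fibre but may differ.\<close>

definition transversal :: "(int \<Rightarrow> 'a) \<Rightarrow> bool" where
  "transversal r \<longleftrightarrow> (\<forall>t. r t \<in> V \<and> c (r t) mod n = t mod n)"

lemma transversal_exists: "\<exists>r. transversal r"
  unfolding transversal_def using inhabited by metis

lemma transversal_dominates:
  assumes "transversal r" "x \<in> V" "c x mod n = (s + e) mod n" "e \<in> {-1, 0, 1}"
  shows "x = r s \<or> (r s, x) \<in> parcs blowup"
proof -
  have "c x mod n = (c (r s) + e) mod n"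
    using assms mod_shift[of "c (r s)" e s] by (simp add: transversal_def)
  then show ?thesis using assms unfolding arc_iff transversal_def by blast
qed

lemma transversal_step:
  assumes "transversal r"
  shows "(r t, r (t + 1)) \<in> parcs blowup"
proof -
  have "(t + 1) mod n \<noteq> t mod n" using n_ge_5 by (simp add: mod_eq_dvd_iff)
  then have "r (t + 1) \<noteq> r t"
    using assms unfolding transversal_def by metis
  then show ?thesis
    using transversal_dominates[OF assms, of "r (t + 1)" t 1] assms
    by (auto simp: transversal_def)
qed

lemma transversal_path:
  assumes "transversal r" "r ` {a..b} \<subseteq> D" "s \<in> {a..b}" "t \<in> {a..b}"
  shows "(r s, r t) \<in> (parcs blowup \<inter> D \<times> D)\<^sup>*"
proof (rule rtrancl_interval)
  show "sym (parcs blowup \<inter> D \<times> D)" using sym_blowup by (auto simp: sym_def)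
  show "(r t, r (t + 1)) \<in> parcs blowup \<inter> D \<times> D" if "a \<le> t" "t < b" for t
    using transversal_step[OF assms(1), of t] assms(2) that by auto
qed (use assms in auto)

text \<open>\<open>P i\<close> says that \<open>D\<close> meets the fibre at \<open>i\<close>.
  Domination forbids three consecutive missed positions, and connectivity allows only one run of
  missed positions. So at most two residues are missed, and each of the others costs a vertex of
  \<open>D\<close>.\<close>

lemma connected_dominating_set_card_ge:
  assumes D: "connected_dominating_set blowup D"
  shows "n - 2 \<le> int (card D)"
proof -
  define P where "P i \<longleftrightarrow> (\<exists>u\<in>D. c u mod n = i mod n)" for i
  have DV: "D \<subseteq> V" and conn: "connected (with_proj blowup \<restriction> D)"
    using D by (auto simp: connected_dominating_set_def)
  have no_triple: "P (i - 1) \<or> P i \<or> P (i + 1)" for i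
  proof -
    obtain v where v: "v \<in> V" "c v mod n = i mod n" using inhabited by blast
    then have "v \<in> D \<or> (\<exists>u\<in>D. (u, v) \<in> parcs blowup)"
      using D by (simp add: connected_dominating_set_def)
    then have "v \<in> D \<or> (\<exists>u\<in>D. (v, u) \<in> parcs blowup)"
      using symD[OF sym_blowup] by blast
    then obtain u where "u \<in> D" "u = v \<or> (v, u) \<in> parcs blowup" by blast
    moreover from this(2) obtain e where "e \<in> {-1, 0, 1}" "c u mod n = (c v + e) mod n"
      unfolding arc_iff by force
    moreover have "(c v + e) mod n = (i + e) mod n" using v(2) by (simp add: mod_shift)
    ultimately show ?thesis by (auto simp: P_def)
  qed
  \<comment> \<open>two gaps on the cycle would separate the vertices of \<open>D\<close> on the two arcs between them\<close>
  have one_gap: "i mod n = j mod n"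
    if "P i" "\<not> P (i + 1)" "P j" "\<not> P (j + 1)" for i j
  proof (rule ccontr)
    assume ij: "i mod n \<noteq> j mod n"
    \<comment> \<open>Positions are measured from \<open>i\<close>, so \<open>j\<close> lies at
      \<open>J\<close>, and \<open>X\<close> consists of positions 1 to \<open>J\<close>. An arc
      leaving \<open>X\<close> goes from 1 down to 0 or from \<open>J\<close> up to
      \<open>J + 1\<close>, but \<open>D\<close> misses positions 1 and
      \<open>J + 1\<close>.\<close>
    define t where "t u = (c u - i) mod n" for u
    define J where "J = (j - i) mod n"
    have t: "0 \<le> t u" "t u < n" for u using n_ge_5 by (simp_all add: t_def)
    have J: "0 < J"
    proof -
      have "J \<noteq> 0" using ij by (metis J_def dvd_eq_mod_eq_0 mod_eq_dvd_iff)
      then show ?thesis using n_ge_5 by (simp add: J_def order.strict_iff_order)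
    qed
    have t_eq: "t u = (s - i) mod n \<longleftrightarrow> c u mod n = s mod n" for u s
      using mod_shift[of "c u" "- i" s] by (simp add: t_def)
    obtain x where x: "x \<in> D" "c x mod n = j mod n" using \<open>P j\<close> by (auto simp: P_def)
    obtain y where y: "y \<in> D" "c y mod n = i mod n" using \<open>P i\<close> by (auto simp: P_def)
    have "t x = J" using x t_eq[of x j] by (simp add: J_def)
    have "t y = 0" using y t_eq[of y i] by simp
    define X where "X = {u. 0 < t u \<and> t u \<le> J}"
    have "x \<in> X" "y \<notin> X" using \<open>t x = J\<close> \<open>t y = 0\<close> J by (simp_all add: X_def)
    then obtain u v where "u \<in> X" "v \<notin> X" and uv': "u \<in> D" "v \<in> D" "(u, v) \<in> parcs blowup"
      using connected_induce_crossing_arc[OF sym_blowup conn _ x(1) y(1)] by metis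
    then have uv: "0 < t u" "t u \<le> J" "\<not> (0 < t v \<and> t v \<le> J)" "u \<in> D" "v \<in> D"
      "(u, v) \<in> parcs blowup"
      by (simp_all add: X_def)
    obtain e where e: "e \<in> {-1, 0, 1}" "c v mod n = (c u + e) mod n"
      using uv(6) unfolding arc_iff by blast
    have tv: "t v = (t u + e) mod n"
      using t_eq[of v "c u + e"] e(2) mod_add_left_eq[of "c u - i" n e]
      by (simp add: t_def algebra_simps)
    have "t u \<noteq> 1"
    proof
      assume "t u = 1"
      then have "c u mod n = (i + 1) mod n" using t_eq[of u "i + 1"] n_ge_5 by simp
      then show False using uv(4) \<open>\<not> P (i + 1)\<close> by (auto simp: P_def)
    qed
    \<comment> \<open>The reduction modulo \<open>n\<close> covers \<open>J = n - 1\<close>, where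
      \<open>J + 1\<close> wraps round to 0.\<close>
    have "t v \<noteq> (J + 1) mod n"
    proof
      assume "t v = (J + 1) mod n"
      then have "t v = (j + 1 - i) mod n" using mod_add_left_eq[of "j - i" n 1]
        by (simp add: J_def algebra_simps)
      then have "c v mod n = (j + 1) mod n" using t_eq by blast
      then show False using uv(5) \<open>\<not> P (j + 1)\<close> by (auto simp: P_def)
    qed
    have Jn: "J < n" using n_ge_5 by (simp add: J_def)
    from e(1) consider "e = -1" | "e = 0" | "e = 1" by blast
    then show False
    proof cases
      case 1
      then have "t v = t u - 1" using tv uv(1) t(2)[of u] by simp
      then show False using uv(1-3) \<open>t u \<noteq> 1\<close> by linarith
    next
      case 2
      then have "t v = t u" using tv uv(1) t(2)[of u] by simp
      then show False using uv(1-3) by simp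
    next
      case 3
      show False
      proof (cases "t u = J")
        case True
        then show False using tv 3 \<open>t v \<noteq> (J + 1) mod n\<close> by simp
      next
        case False
        then have "t v = t u + 1" using tv 3 uv(1,2) Jn by simp
        then show False using uv(1-3) False by linarith
      qed
    qed
  qed
  \<comment> \<open>The run of missed positions starts right after \<open>s\<close>. For a missed
    \<open>z\<close>, the last position met before it is \<open>z - 1\<close> or
    \<open>z - 2\<close>, and \<open>one_gap\<close> identifies that position with
    \<open>s\<close>.\<close>
  have "\<exists>s. \<forall>z. \<not> P z \<longrightarrow> z mod n = (s + 1) mod n \<or> z mod n = (s + 2) mod n"
  proof (cases "\<exists>s. P s \<and> \<not> P (s + 1)")
    case True
    then obtain s where s: "P s" "\<not> P (s + 1)" by blast
    have "z mod n = (s + 1) mod n \<or> z mod n = (s + 2) mod n" if "\<not> P z" for z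
    proof (cases "P (z - 1)")
      case True
      then have "s mod n = (z - 1) mod n" using one_gap[OF s, of "z - 1"] that by simp
      then show ?thesis using mod_shift[of s 1 "z - 1"] by simp
    next
      case False
      then have "P (z - 2)" using no_triple[of "z - 1"] that by simp
      then have "s mod n = (z - 2) mod n" using one_gap[OF s, of "z - 2"] False by simp
      then show ?thesis using mod_shift[of s 2 "z - 2"] by simp
    qed
    then show ?thesis by blast
  next
    case False
    \<comment> \<open>Without a gap \<open>P\<close> passes from each position to the next, and one
      of \<open>z - 2\<close>, \<open>z - 1\<close>, \<open>z\<close> is met.\<close>
    have "P z" for z
      using no_triple[of "z - 1"] False by (metis diff_add_cancel diff_add_eq add.commute)
    then show ?thesis by blast
  qed
  then obtain s where s: "\<And>z. \<not> P z \<Longrightarrow> z mod n = (s + 1) mod n \<or> z mod n = (s + 2) mod n"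
    by blast
  have "{0..<n} - {(s + 1) mod n, (s + 2) mod n} \<subseteq> (\<lambda>u. c u mod n) ` D"
  proof
    fix z assume z: "z \<in> {0..<n} - {(s + 1) mod n, (s + 2) mod n}"
    then have "z mod n = z" by simp
    then have "P z" using s[of z] z by auto
    then show "z \<in> (\<lambda>u. c u mod n) ` D" using \<open>z mod n = z\<close> by (auto simp: P_def)
  qed
  moreover have "finite D" using DV finite_V finite_subset by blast
  ultimately have "card ({0..<n} - {(s + 1) mod n, (s + 2) mod n}) \<le> card D"
    by (rule surj_card_le[rotated])
  moreover have "card {0..<n} - card {(s + 1) mod n, (s + 2) mod n} \<le>
      card ({0..<n} - {(s + 1) mod n, (s + 2) mod n})"
    by (rule diff_card_le_card_Diff) simp
  moreover have "card {(s + 1) mod n, (s + 2) mod n} \<le> 2" by (simp add: card_insert_if)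
  ultimately show ?thesis by simp
qed

text \<open>For the upper bound, a path through positions 0 to \<open>n - 3\<close> suffices: the
  two positions left out are adjacent to its ends.\<close>

lemma connected_domination_number_blowup:
  "connected_domination_number blowup = enat (nat (n - 2))"
proof (rule antisym)
  obtain r where r: "transversal r" using transversal_exists by blast
  let ?D = "r ` {0..n - 3}"
  have "connected_dominating_set blowup ?D"
    unfolding connected_dominating_set_def
  proof (intro conjI ballI)
    show "?D \<subseteq> pverts blowup" using r by (auto simp: transversal_def)
    show "connected (with_proj blowup \<restriction> ?D)"
      using n_ge_5 transversal_path[OF r order.refl]
      by (intro connected_induceI[OF sym_blowup, of "r 0"]) auto
    fix x assume "x \<in> pverts blowup"
    then have x: "x \<in> V" by simp
    define t where "t = c x mod n"
    have t: "0 \<le> t" "t < n" "c x mod n = t mod n" using n_ge_5 by (simp_all add: t_def)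
    have "\<exists>s\<in>{0..n - 3}. x = r s \<or> (r s, x) \<in> parcs blowup"
    proof -
      consider "t \<le> n - 3" | "t = n - 2" | "t = n - 1" using t by linarith
      then show ?thesis
      proof cases
        case 1
        then show ?thesis using t transversal_dominates[OF r x, of t 0] by auto
      next
        case 2
        then have "c x mod n = (n - 3 + 1) mod n" using t by simp
        then show ?thesis using n_ge_5 transversal_dominates[OF r x, of "n - 3" 1] by auto
      next
        case 3
        then have "c x mod n = (0 + - 1) mod n" using t n_ge_5 by (simp add: zmod_minus1)
        then show ?thesis using n_ge_5 transversal_dominates[OF r x, of 0 "- 1"] by auto
      qed
    qed
    then show "x \<in> ?D \<or> (\<exists>u\<in>?D. (u, x) \<in> parcs blowup)" by blast
  qed
  then have "connected_domination_number blowup \<le> enat (card ?D)"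
    by (rule connected_domination_number_le)
  also have "card ?D \<le> nat (n - 2)"
    using card_image_le[of "{0..n - 3}" r] n_ge_5 by simp
  finally show "connected_domination_number blowup \<le> enat (nat (n - 2))" by simp
next
  show "enat (nat (n - 2)) \<le> connected_domination_number blowup"
    unfolding connected_domination_number_def
    by (rule INF_greatest) (use connected_dominating_set_card_ge in fastforce)
qed

text \<open>Leaving out one position after \<open>u\<close> and two after \<open>v\<close> keeps
  \<open>n - 3\<close> positions in two arcs, one ending at \<open>v\<close> and the other at
  \<open>u\<close>. The bounds on \<open>d\<close> make both arcs nonempty, and the new edge
  connects them.\<close>

lemma connected_domination_number_add_edge_aux:
  assumes uv: "u \<in> V" "v \<in> V" and d: "2 \<le> d" "d \<le> n - 3" "c v mod n = (c u + d) mod n"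
  shows "connected_domination_number (add_edge blowup u v) < enat (nat (n - 2))"
proof -
  obtain r0 where r0: "transversal r0" using transversal_exists by blast
  define i where "i = c u"
  \<comment> \<open>The new edge joins two particular vertices, not their fibres, so the transversal
    is altered to pass through \<open>u\<close> and \<open>v\<close>.\<close>
  define r where "r t = (if t mod n = i mod n then u else if t mod n = (i + d) mod n then v else r0 t)" for t
  have r: "transversal r"
    using r0 uv d by (auto simp: transversal_def r_def i_def)
  have ru: "r (i + n) = u" by (simp add: r_def)
  have "\<not> n dvd d" using d by (auto dest: zdvd_imp_le)
  then have "(i + d) mod n \<noteq> i mod n" by (simp add: mod_eq_dvd_iff)
  then have rv: "r (i + d) = v" by (simp add: r_def)
  \<comment> \<open>the positions \<open>i + 1\<close>, \<open>i + d + 1\<close> and \<open>i + d + 2\<close> are left out; the new edge joins the two arcs\<close>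
  define A where "A = {i + 2..i + d}"
  define B where "B = {i + d + 3..i + n}"
  define D where "D = r ` (A \<union> B)"
  let ?G = "add_edge blowup u v"
  have sym: "sym (parcs ?G)" by (simp only: sym_add_edge sym_blowup)
  have "connected_dominating_set ?G D"
    unfolding connected_dominating_set_def
  proof (intro conjI ballI)
    show "D \<subseteq> pverts ?G" using r by (auto simp: transversal_def D_def)
    have uD: "u \<in> D" and vD: "v \<in> D"
      using ru rv d by (force simp: D_def A_def B_def)+
    have mono: "(parcs blowup \<inter> D \<times> D)\<^sup>* \<subseteq> (parcs ?G \<inter> D \<times> D)\<^sup>*"
      by (rule rtrancl_mono) auto
    show "connected (with_proj ?G \<restriction> D)"
    proof (rule connected_induceI[OF sym vD])
      fix x assume "x \<in> D"
      then consider t where "t \<in> A" "x = r t" | t where "t \<in> B" "x = r t"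
        by (auto simp: D_def)
      then show "(v, x) \<in> (parcs ?G \<inter> D \<times> D)\<^sup>*"
      proof cases
        case 1
        then have "(r (i + d), x) \<in> (parcs blowup \<inter> D \<times> D)\<^sup>*"
          using transversal_path[OF r, of "i + 2" "i + d" D "i + d" t] d
          by (auto simp: D_def A_def)
        then show ?thesis using mono rv by auto
      next
        case 2
        then have "(r (i + n), x) \<in> (parcs blowup \<inter> D \<times> D)\<^sup>*"
          using transversal_path[OF r, of "i + d + 3" "i + n" D "i + n" t] d
          by (auto simp: D_def B_def)
        then have "(u, x) \<in> (parcs ?G \<inter> D \<times> D)\<^sup>*" using mono ru by auto
        moreover have "(v, u) \<in> parcs ?G \<inter> D \<times> D" using uD vD by simp
        ultimately show ?thesis by (rule converse_rtrancl_into_rtrancl[rotated])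
      qed
    qed
    fix x assume "x \<in> pverts ?G"
    then have x: "x \<in> V" by simp
    define t where "t = (c x - i) mod n"
    have t: "0 \<le> t" "t < n" using n_ge_5 by (simp_all add: t_def)
    have cx: "c x mod n = (i + t) mod n" by (simp add: t_def mod_simps)
    have dom: "\<exists>s\<in>A \<union> B. x = r s \<or> (r s, x) \<in> parcs blowup"
      if "s \<in> A \<union> B" "e \<in> {-1, 0, 1}" "c x mod n = (s + e) mod n" for s e
      using that transversal_dominates[OF r x] by blast
    have "\<exists>s\<in>A \<union> B. x = r s \<or> (r s, x) \<in> parcs blowup"
    proof -
      consider "t = 0 \<or> t = 1" | "2 \<le> t" "t \<le> d" | "t = d + 1" | "t = d + 2" | "d + 3 \<le> t"
        using t by linarith
      then show ?thesis
      proof cases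
        case 1
        \<comment> \<open>Offsets 0 and 1 are served by \<open>u\<close>, which enters the set as
          position \<open>i + n\<close>, the upper end of \<open>B\<close>.\<close>
        have "c x mod n = (i + n + t) mod n"
          using cx mod_add_self2[of "i + t" n] by (simp add: algebra_simps)
        then show ?thesis using 1 d by (intro dom[of "i + n" t]) (auto simp: A_def B_def)
      next
        case 2
        then show ?thesis using cx by (intro dom[of "i + t" 0]) (auto simp: A_def)
      next
        case 3
        then show ?thesis using cx d by (intro dom[of "i + d" 1]) (auto simp: A_def algebra_simps)
      next
        case 4
        then show ?thesis using cx d
          by (intro dom[of "i + d + 3" "-1"]) (auto simp: B_def algebra_simps)
      next
        case 5
        then show ?thesis using cx t by (intro dom[of "i + t" 0]) (auto simp: B_def)
      qed
    qed
    then show "x \<in> D \<or> (\<exists>w\<in>D. (w, x) \<in> parcs ?G)"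
      by (auto simp: D_def)
  qed
  then have "connected_domination_number ?G \<le> enat (card D)"
    by (rule connected_domination_number_le)
  moreover have "card D < nat (n - 2)"
  proof -
    have "card D \<le> card A + card B"
      unfolding D_def A_def B_def by (meson card_Un_le card_image_le finite_Un finite_atLeastAtMost_int order_trans)
    also have "card A + card B = nat (d - 1) + nat (n - d - 2)" by (simp add: A_def B_def)
    also have "\<dots> < nat (n - 2)" using d by linarith
    finally show ?thesis .
  qed
  ultimately show ?thesis by (simp add: order.strict_trans1[of _ "enat (card D)"])
qed

text \<open>Nonadjacent vertices are at offset 2 to \<open>n - 2\<close>. The auxiliary lemma
  handles offsets up to \<open>n - 3\<close>; offset \<open>n - 2\<close> becomes 2 once
  \<open>u\<close> and \<open>v\<close> are swapped, and \<open>2 <= n - 3\<close> holds as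
  \<open>n >= 5\<close>.\<close>

lemma connected_domination_critical_blowup:
  "connected_domination_critical (nat (n - 2)) blowup"
  unfolding connected_domination_critical_def
proof (intro conjI ballI impI)
  fix u v assume "u \<in> pverts blowup" "v \<in> pverts blowup" "u \<noteq> v \<and> (u, v) \<notin> parcs blowup"
  then have uv: "u \<in> V" "v \<in> V" and non: "\<And>e. e \<in> {-1, 0, 1} \<Longrightarrow> c v mod n \<noteq> (c u + e) mod n"
    by (auto simp: arc_iff)
  define d where "d = (c v - c u) mod n"
  have cv: "c v mod n = (c u + d) mod n" by (simp add: d_def mod_simps)
  have "0 \<le> d" "d < n" using n_ge_5 by (simp_all add: d_def)
  moreover have "d \<noteq> 0" "d \<noteq> 1" using cv non[of 0] non[of 1] by auto
  moreover have "d \<noteq> n - 1"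
  proof
    assume "d = n - 1"
    then have "c v mod n = (c u + - 1) mod n"
      using cv mod_add_self2[of "c u - 1" n] by (simp add: add.commute add_diff_eq)
    then show False using non[of "-1"] by simp
  qed
  ultimately consider "2 \<le> d" "d \<le> n - 3" | "d = n - 2" by linarith
  then show "connected_domination_number (add_edge blowup u v) < enat (nat (n - 2))"
  proof cases
    case 1
    then show ?thesis using connected_domination_number_add_edge_aux uv cv by blast
  next
    case 2
    have "(c v + 2) mod n = (c u + d + 2) mod n" using cv by (simp add: mod_shift)
    also have "\<dots> = c u mod n" using 2 by simp
    finally have "c u mod n = (c v + 2) mod n" by simp
    then show ?thesis
      using connected_domination_number_add_edge_aux[of v u 2] uv n_ge_5
      by (simp add: add_edge_commute[of _ u v])
  qed
qed (rule connected_domination_number_blowup)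

end

section \<open>The counterexamples for \<open>k \<ge> 3\<close>\<close>

text \<open>
  The fibres have sizes \<open>1, 3, 1, 3, 2, \<dots>, 2\<close>: deleting the singletons at the positions 0 and 2
  cuts off the triangle at position 1.
\<close>

definition position :: "nat \<Rightarrow> nat" where
  "position j = (if j = 1 then 1 else if j = 5 then 3 else j div 2)"

text \<open>The numbers below \<open>2 * (k + 2)\<close> are embedded into the infinite type by
  \<open>f\<close>. Starting from the pair \<open>2 * p\<close>, \<open>2 * p + 1\<close> at each
  position \<open>p\<close>, only 1 and 5 are moved up by one position, so the order stays
  even.\<close>

lemma exists_not_bi_critical:
  assumes "3 \<le> k"
  obtains G :: "('a :: infinite) pair_pre_digraph"
  where "pair_graph G" "connected_domination_critical k G" "claw_free G"
    "even (card (pverts G))" "min_degree G \<ge> 3" "\<not> bi_critical G"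
proof -
  obtain f :: "nat \<Rightarrow> 'a" where f: "inj f"
    using infinite_countable_subset[OF infinite_UNIV] by blast
  define V where "V = f ` {..<2 * (k + 2)}"
  define c where "c x = int (position (inv f x))" for x
  have cf [simp]: "c (f j) = int (position j)" for j using f by (simp add: c_def)
  have inV: "f j \<in> V \<longleftrightarrow> j < 2 * (k + 2)" for j using f by (auto simp: V_def inj_def)
  define n where "n = int (k + 2)"
  interpret cycle_blowup V c n
  proof
    show "finite V" by (simp add: V_def)
    show "5 \<le> n" using assms by (simp add: n_def)
    fix i :: int
    define j where "j = nat (i mod n)"
    have j: "int j = i mod n" by (simp add: j_def n_def)
    also have "\<dots> < int (k + 2)" unfolding n_def by (rule pos_mod_bound) simp
    \<comment> \<open>Only odd numbers were moved, so \<open>2 * j\<close> still represents position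
      \<open>j\<close>.\<close>
    finally have "f (2 * j) \<in> V" by (simp add: inV)
    moreover have "position (2 * j) = j" by (auto simp: position_def)
    then have "c (f (2 * j)) mod n = i mod n" by (simp add: j)
    ultimately show "\<exists>u\<in>V. c u mod n = i mod n" by blast
  qed
  have arcI: "(f i, f j) \<in> parcs blowup"
    if "i \<noteq> j" "i < 2 * (k + 2)" "j < 2 * (k + 2)"
      "position j = position i \<or> position j = position i + 1 \<or> position i = position j + 1" for i j
  proof -
    have "\<exists>e\<in>{-1, 0, 1}. int (position j) = int (position i) + e" using that(4) by auto
    then have "\<exists>e\<in>{-1, 0, 1}. c (f j) mod n = (c (f i) + e) mod n" unfolding cf by metis
    then show ?thesis unfolding arc_iff inV using that f by (simp add: inj_eq)
  qed
  have "3 \<le> min_degree blowup"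
  proof (rule min_degree_geI)
    interpret pair_graph blowup by (rule pair_graph_blowup)
    show "finite (pverts blowup)" "finite (parcs blowup)"
      by (rule pair_finite_verts, rule pair_finite_arcs)
    have "f 0 \<in> V" by (simp add: inV)
    then show "pverts blowup \<noteq> {}" by auto
    fix v assume "v \<in> pverts blowup"
    then have "v \<in> V" by simp
    then obtain j where j: "v = f j" "j < 2 * (k + 2)" unfolding V_def by blast
    have three: "\<exists>W. card W = 3 \<and> Pair v ` W \<subseteq> parcs blowup"
      if "x \<noteq> y" "x \<noteq> z" "y \<noteq> z" "(f j, f x) \<in> parcs blowup" "(f j, f y) \<in> parcs blowup"
        "(f j, f z) \<in> parcs blowup" for x y z
      using that j f by (intro exI[of _ "{f x, f y, f z}"]) (auto simp: inj_eq)
    \<comment> \<open>From 8 on the pattern is regular: the partner in the same fibre and the two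
      vertices one position below are neighbours.\<close>
    consider "j = 0" | "j = 1" | "j = 2" | "j = 3" | "j = 4" | "j = 5" | "j = 6" | "j = 7"
      | "8 \<le> j" "even j" | "8 \<le> j" "odd j" by linarith
    then show "\<exists>W. card W = 3 \<and> Pair v ` W \<subseteq> parcs blowup"
    proof cases
      case 1
      then show ?thesis using assms
        by (intro three[of 1 2 3] arcI) (auto simp: position_def)
    next
      case 2
      then show ?thesis using assms
        by (intro three[of 0 2 3] arcI) (auto simp: position_def)
    next
      case 3
      then show ?thesis using assms
        by (intro three[of 0 1 3] arcI) (auto simp: position_def)
    next
      case 4
      then show ?thesis using assms
        by (intro three[of 0 1 2] arcI) (auto simp: position_def)
    next
      case 5
      then show ?thesis using assms
        by (intro three[of 1 2 3] arcI) (auto simp: position_def)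
    next
      case 6
      then show ?thesis using assms
        by (intro three[of 4 6 7] arcI) (auto simp: position_def)
    next
      case 7
      then show ?thesis using assms
        by (intro three[of 5 7 8] arcI) (auto simp: position_def)
    next
      case 8
      then show ?thesis using assms
        by (intro three[of 5 6 8] arcI) (auto simp: position_def)
    next
      case 9
      then have "\<exists>i. j = 2 * i + 8" by presburger
      then obtain i where i: "j = 2 * i + 8" by blast
      \<comment> \<open>An even \<open>j\<close> below an even bound leaves room for its partner
        \<open>j + 1\<close>.\<close>
      have "j + 1 < 2 * (k + 2)" using j i by presburger
      then show ?thesis using i
        by (intro three[of "j - 2" "j - 1" "j + 1"] arcI) (auto simp: position_def)
    next
      case 10
      then have "\<exists>i. j = 2 * i + 9" by presburger
      then obtain i where "j = 2 * i + 9" by blast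
      then show ?thesis using j
        by (intro three[of "j - 3" "j - 2" "j - 1"] arcI) (auto simp: position_def)
    qed
  qed
  moreover have "\<not> bi_critical blowup"
  proof
    assume "bi_critical blowup"
    have "even (card {f 1, f 2, f 3})"
    proof (rule bi_critical_closed_even[OF pair_graph_blowup \<open>bi_critical blowup\<close>])
      show "{f 0, f 4} \<subseteq> pverts blowup" using assms by (simp add: inV)
      show "card {f 0, f 4} = 2" using f by (simp add: inj_eq card_insert_if)
      show "{f 1, f 2, f 3} \<subseteq> pverts blowup - {f 0, f 4}"
        using f assms by (auto simp: inV inj_eq)
      fix u v assume uv: "(u, v) \<in> parcs blowup" "u \<in> {f 1, f 2, f 3}" "v \<notin> {f 0, f 4}"
      then have "v \<in> V" by (simp add: arc_iff)
      then obtain j where j: "v = f j" "j < 2 * (k + 2)" unfolding V_def by blast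
      have "c u = 1" using uv(2) by (auto simp: position_def)
      moreover obtain e where "e \<in> {-1, 0, 1}" "c v mod n = (c u + e) mod n"
        using uv(1) unfolding arc_iff by blast
      ultimately have e: "e \<in> {-1, 0, 1}" "int (position j) mod n = (1 + e) mod n"
        using j(1) by simp_all
      have "position j < k + 2" using j assms by (auto simp: position_def)
      \<comment> \<open>Both sides lie between 0 and \<open>n - 1\<close>, so congruence is
        equality. Positions 0 to 2 hold only the vertices numbered 0 to 4, since 5 was moved to
        position 3.\<close>
      then have "int (position j) = 1 + e" using e assms by (auto simp: n_def)
      then have "j \<le> 4" using e(1) by (auto simp: position_def split: if_splits)
      then have "j \<in> {0, 1, 2, 3, 4}" by auto
      then show "v \<in> {f 1, f 2, f 3}" using j uv(3) by auto
    qed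
    then show False using f by (simp add: inj_eq card_insert_if)
  qed
  moreover have "connected_domination_critical k blowup"
    using connected_domination_critical_blowup by (simp add: n_def)
  moreover have "even (card V)"
    unfolding V_def using f by (simp add: card_image inj_on_subset)
  then have "even (card (pverts blowup))" by simp
  ultimately show ?thesis using that pair_graph_blowup claw_free_blowup by blast
qed

theorem theorem5:
  fixes k :: nat
  assumes "k \<ge> 1"
  shows "(\<forall>G :: ('a :: infinite) pair_pre_digraph.
            pair_graph G \<and> connected_domination_critical k G \<and> claw_free G \<and>
            even (card (pverts G)) \<and> min_degree G \<ge> 3 \<longrightarrow> bi_critical G)
         \<longleftrightarrow> k \<in> {1, 2}"
proof
  assume all: "\<forall>G :: 'a pair_pre_digraph.
    pair_graph G \<and> connected_domination_critical k G \<and> claw_free G \<and>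
    even (card (pverts G)) \<and> min_degree G \<ge> 3 \<longrightarrow> bi_critical G"
  have "\<not> 3 \<le> k"
  proof
    assume "3 \<le> k"
    then obtain G :: "'a pair_pre_digraph" where "pair_graph G" "connected_domination_critical k G"
      "claw_free G" "even (card (pverts G))" "min_degree G \<ge> 3" "\<not> bi_critical G"
      by (rule exists_not_bi_critical)
    with all show False by blast
  qed
  with assms show "k \<in> {1, 2}" by auto
next
  assume "k \<in> {1, 2}"
  then have "k \<le> 2" by auto
  then show "\<forall>G :: 'a pair_pre_digraph.
    pair_graph G \<and> connected_domination_critical k G \<and> claw_free G \<and>
    even (card (pverts G)) \<and> min_degree G \<ge> 3 \<longrightarrow> bi_critical G"
    using critical_le_2_imp_bi_critical by blast
qed

end
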